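(* Let $f$ be a relation on a Hausdorff uniform space $(X,\mathcal U)$ with gage $\Gamma$. (a) Let $\mathcal L_\ell$ be the set of bounded, uniformly continuous functions $L:X\to\mathbb R$ which are $K\ell_d^f$ dominated for some $d\in\Gamma$ and some positive $K$. Each $L\in\mathcal L_\ell$ is an $\mathcal A_{\mathcal U}f$ Lyapunov function and so satisfies $\mathcal A_{\mathcal U}f\subset\ \le_L$ and $|\mathcal A_{\mathcal U}f|\subset|L|_{\mathcal A_{\mathcal U}f}$. The collection $\mathcal L_\ell$ satisfies the conditions ALG, CON and POIN with respect to $F=\mathcal A_{\mathcal U}f$. (b) Let $\mathcal L_m$ be the set of bounded, uniformly continuous functions $L:X\to\mathbb R$ which are $Km_d^f$ dominated for some $d\in\Gamma$ and some positive $K$. Each $L\in\mathcal L_m$ is a $\mathcal C_{\mathcal U}f$ Lyapunov function and so satisfies $\mathcal C_{\mathcal U}f\subset\ \le_L$ and $|\mathcal C_{\mathcal U}f|\subset|L|_{\mathcal C_{\mathcal U}f}$. The collection $\mathcal L_m$ satisfies the conditions ALG, CON and POIN with respect to $F=\mathcal C_{\mathcal U}f$.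
   Context: $X$ is nonempty; a relation on $X$ is a subset of $X\times X$; $|f|=\{x:(x,x)\in f\}$; $f^{-1}=\{(y,x):(x,y)\in f\}$; $f(x)=\{y:(x,y)\in f\}$; $1_X$ is the diagonal. The gage $\Gamma=\Gamma(\mathcal U)$ is the set of all bounded pseudo-metrics $d$ on $X$ with $\{(x,y):d(x,y)<\epsilon\}\in\mathcal U$ for every $\epsilon>0$. For $d\in\Gamma$ the barrier functions are $$\ell_d^f(x,y)=\inf\Big\{d(x,a_1)+\sum_{i=1}^{n-1}d(b_i,a_{i+1})+d(b_n,y)\Big\},\quad m_d^f(x,y)=\inf\{\max(d(x,a_1),d(b_1,a_2),\dots,d(b_{n-1},a_n),d(b_n,y))\},$$ infima over all $n\ge1$ and all sequences $(a_1,b_1),\dots,(a_n,b_n)$ in $f$ (for $f=\emptyset$: $m_d^\emptyset=\mathrm{diam}(X)$, $\ell_d^\emptyset=2\,\mathrm{diam}(X)$). Set $\mathcal C_{\mathcal U}f=\bigcap_{d\in\Gamma}\{m_d^f=0\}$ and $\mathcal A_{\mathcal U}f=\bigcap_{d\in\Gamma}\{\ell_d^f=0\}$; these are closed transitive relations. $L$ is $K\ell_d^f$ dominated if $L(x)-L(y)\le K\ell_d^f(x,y)$ for all $x,y\in X$, and $Km_d^f$ dominated if $L(x)-L(y)\le Km_d^f(x,y)$ for all $x,y\in X$. $\le_L\ =\{(x,y):L(x)\le L(y)\}$. A Lyapunov function for a relation $F$ is a continuous $L:X\to\mathbb R$ with $F\subset\ \le_L$. A point $x$ is $F$-regular for $L$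 if $L(z)<L(x)<L(w)$ for all $z\in F^{-1}(x)$ and $w\in F(x)$ (each condition being vacuous when the set is empty), and $F$-critical otherwise; $|L|_F$ is the set of $F$-critical points. For a closed transitive relation $F$ and a collection $\mathcal L$ of Lyapunov functions for $F$: ALG: if $L_1,L_2\in\mathcal L$ and $c\ge0$ then $L_1+L_2,\max(L_1,L_2),\min(L_1,L_2),cL_1,c,-c\in\mathcal L$ (where $c,-c$ denote constant functions). CON: for every sequence $\{L_k\}$ in $\mathcal L$ there is a summable sequence of positive reals $\{a_k\}$ such that $\sum_ka_kL_k$ converges uniformly to an element of $\mathcal L$. POIN: if $(x,y)\notin1_X\cup F$ then there is $L\in\mathcal L$ with $L(y)<L(x)$, i.e. $1_X\cup F=\bigcap_{L\in\mathcal L}\le_L$. *)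

theory Defs
  imports "HOL-Analysis.Analysis"
begin

text \<open>
  The uniform space \<open>X\<close> is a type of class \<^class>\<open>uniform_space\<close>; types are nonempty.
  \<open>E \<in> \<U>\<close> is rendered as \<open>eventually (\<lambda>p. p \<in> E) uniformity\<close>.  For relations the library
  notions are used: \<open>f\<inverse>\<close> for the inverse, \<open>f `` {x}\<close> for \<open>f(x)\<close>, and \<^const>\<open>Id\<close> for the
  diagonal.
\<close>

definition fixed_points :: "'a rel \<Rightarrow> 'a set" where
  "fixed_points f = {x. (x, x) \<in> f}"

definition bounded_pseudometric :: "('a \<Rightarrow> 'a \<Rightarrow> real) \<Rightarrow> bool" where
  "bounded_pseudometric d \<longleftrightarrow>
     (\<forall>x y. 0 \<le> d x y) \<and> (\<forall>x. d x x = 0) \<and> (\<forall>x y. d x y = d y x) \<and>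
     (\<forall>x y z. d x z \<le> d x y + d y z) \<and> (\<exists>B. \<forall>x y. d x y \<le> B)"

definition gage :: "('a::uniform_space \<Rightarrow> 'a \<Rightarrow> real) set" where
  "gage = {d. bounded_pseudometric d \<and>
              (\<forall>\<epsilon>>0. eventually (\<lambda>(x, y). d x y < \<epsilon>) uniformity)}"

definition diam :: "('a \<Rightarrow> 'a \<Rightarrow> real) \<Rightarrow> real" where
  "diam d = (SUP (x, y). d x y)"

text \<open>
  A sequence \<open>(a\<^sub>1, b\<^sub>1), \<dots>, (a\<^sub>n, b\<^sub>n)\<close> in \<open>f\<close> is given by a length \<open>n \<ge> 1\<close> and two
  functions \<open>a\<close>, \<open>b\<close>, of which only the values at \<open>1, \<dots>, n\<close> matter.
\<close>

definition is_chain :: "'a rel \<Rightarrow> nat \<Rightarrow> (nat \<Rightarrow> 'a) \<Rightarrow> (nat \<Rightarrow> 'a) \<Rightarrow> bool" where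
  "is_chain f n a b \<longleftrightarrow> n \<ge> 1 \<and> (\<forall>i\<in>{1..n}. (a i, b i) \<in> f)"

definition barrier_l :: "('a \<Rightarrow> 'a \<Rightarrow> real) \<Rightarrow> 'a rel \<Rightarrow> 'a \<Rightarrow> 'a \<Rightarrow> real" where
  "barrier_l d f x y =
     (if f = {} then 2 * diam d
      else Inf {d x (a 1) + (\<Sum>i=1..<n. d (b i) (a (i + 1))) + d (b n) y | n a b.
                  is_chain f n a b})"

definition barrier_m :: "('a \<Rightarrow> 'a \<Rightarrow> real) \<Rightarrow> 'a rel \<Rightarrow> 'a \<Rightarrow> 'a \<Rightarrow> real" where
  "barrier_m d f x y =
     (if f = {} then diam d
      else Inf {Max ({d x (a 1)} \<union> (\<lambda>i. d (b i) (a (i + 1))) ` {1..<n} \<union> {d (b n) y}) | n a b.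
                  is_chain f n a b})"

definition conley_rel :: "'a::uniform_space rel \<Rightarrow> 'a rel" where
  "conley_rel f = (\<Inter>d\<in>gage. {(x, y). barrier_m d f x y = 0})"

definition aubry_mather_rel :: "'a::uniform_space rel \<Rightarrow> 'a rel" where
  "aubry_mather_rel f = (\<Inter>d\<in>gage. {(x, y). barrier_l d f x y = 0})"

definition dominated_by :: "real \<Rightarrow> ('a \<Rightarrow> 'a \<Rightarrow> real) \<Rightarrow> ('a \<Rightarrow> real) \<Rightarrow> bool" where
  "dominated_by K g L \<longleftrightarrow> (\<forall>x y. L x - L y \<le> K * g x y)"

definition le_rel :: "('a \<Rightarrow> real) \<Rightarrow> 'a rel" where
  "le_rel L = {(x, y). L x \<le> L y}"

definition lyapunov_function :: "'a::topological_space rel \<Rightarrow> ('a \<Rightarrow> real) \<Rightarrow> bool" where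
  "lyapunov_function F L \<longleftrightarrow> continuous_on UNIV L \<and> F \<subseteq> le_rel L"

definition regular_point :: "'a rel \<Rightarrow> ('a \<Rightarrow> real) \<Rightarrow> 'a \<Rightarrow> bool" where
  "regular_point F L x \<longleftrightarrow> (\<forall>z \<in> F\<inverse> `` {x}. L z < L x) \<and> (\<forall>w \<in> F `` {x}. L x < L w)"

definition critical_points :: "'a rel \<Rightarrow> ('a \<Rightarrow> real) \<Rightarrow> 'a set" where
  "critical_points F L = {x. \<not> regular_point F L x}"

definition ALG :: "('a \<Rightarrow> real) set \<Rightarrow> bool" where
  "ALG \<L> \<longleftrightarrow>
     (\<forall>L1\<in>\<L>. \<forall>L2\<in>\<L>. \<forall>c\<ge>0.
        (\<lambda>x. L1 x + L2 x) \<in> \<L> \<and> (\<lambda>x. max (L1 x) (L2 x)) \<in> \<L> \<and> (\<lambda>x. min (L1 x) (L2 x)) \<in> \<L> \<and>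
        (\<lambda>x. c * L1 x) \<in> \<L> \<and> (\<lambda>x. c) \<in> \<L> \<and> (\<lambda>x. - c) \<in> \<L>)"

definition CON :: "('a \<Rightarrow> real) set \<Rightarrow> bool" where
  "CON \<L> \<longleftrightarrow>
     (\<forall>L :: nat \<Rightarrow> 'a \<Rightarrow> real. (\<forall>k. L k \<in> \<L>) \<longrightarrow>
        (\<exists>a :: nat \<Rightarrow> real. (\<forall>k. 0 < a k) \<and> summable a \<and>
           (\<exists>M\<in>\<L>. uniform_limit UNIV (\<lambda>n x. \<Sum>k<n. a k * L k x) M sequentially)))"

definition POIN :: "'a rel \<Rightarrow> ('a \<Rightarrow> real) set \<Rightarrow> bool" where
  "POIN F \<L> \<longleftrightarrow> (\<forall>x y. (x, y) \<notin> Id \<union> F \<longrightarrow> (\<exists>L\<in>\<L>. L y < L x))"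

lemma POIN_iff_Inter_le_rel:
  assumes "\<And>L. L \<in> \<L> \<Longrightarrow> lyapunov_function F L"
  shows "POIN F \<L> \<longleftrightarrow> Id \<union> F = (\<Inter>L\<in>\<L>. le_rel L)"
proof
  assume P: "POIN F \<L>"
  show "Id \<union> F = (\<Inter>L\<in>\<L>. le_rel L)"
  proof
    show "Id \<union> F \<subseteq> (\<Inter>L\<in>\<L>. le_rel L)"
      using assms by (fastforce simp: lyapunov_function_def le_rel_def)
    show "(\<Inter>L\<in>\<L>. le_rel L) \<subseteq> Id \<union> F"
    proof (rule subrelI, rule ccontr)
      fix x y assume xy: "(x, y) \<in> (\<Inter>L\<in>\<L>. le_rel L)" "(x, y) \<notin> Id \<union> F"
      then obtain L where "L \<in> \<L>" "L y < L x"
        using P unfolding POIN_def by blast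
      with xy show False by (auto simp: le_rel_def dest!: bspec)
    qed
  qed
next
  assume "Id \<union> F = (\<Inter>L\<in>\<L>. le_rel L)"
  then show "POIN F \<L>"
    unfolding POIN_def by (auto simp: le_rel_def not_le)
qed

definition lyap_l :: "'a::uniform_space rel \<Rightarrow> ('a \<Rightarrow> real) set" where
  "lyap_l f = {L. bounded (range L) \<and> uniformly_continuous_on UNIV L \<and>
                  (\<exists>d\<in>gage. \<exists>K>0. dominated_by K (barrier_l d f) L)}"

definition lyap_m :: "'a::uniform_space rel \<Rightarrow> ('a \<Rightarrow> real) set" where
  "lyap_m f = {L. bounded (range L) \<and> uniformly_continuous_on UNIV L \<and>
                  (\<exists>d\<in>gage. \<exists>K>0. dominated_by K (barrier_m d f) L)}"

end

theory Submission
  imports Defs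
begin

text \<open>
  Both barriers are infima, over chains in \<open>f\<close>, of a cost that is monotone and homogeneous in \<open>d\<close>,
  subadditive under concatenation of chains, and changes by at most \<open>d\<close> when an end point is
  moved; everything follows from these properties.  Since the constant \<open>K\<close> and the modulus of
  uniform continuity can be absorbed into \<open>d\<close>, a bounded function \<open>L\<close> belongs to the collection
  iff some \<open>d\<close> in the gage satisfies \<open>\<bar>L x - L y\<bar> \<le> d x y\<close> and \<open>L x - L y \<le> g d x y\<close>,
  where \<open>g d\<close> is the barrier of \<open>d\<close>.  ALG and CON then reduce to closure of the gage under sums,
  scaling and uniformly convergent series.  For POIN, a point pair with \<open>g d x y > 0\<close> and
  \<open>d x y > 0\<close> is separated by \<open>z \<mapsto> min (g d z y) (d z y)\<close>; a \<open>d\<close> in the gage with \<open>d x y > 0\<close>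
  exists because a sequence of entourages, each containing the threefold composition of the next, can
  be metrized.
\<close>

section \<open>The gage\<close>

lemma gageD:
  assumes "d \<in> gage"
  shows gage_nonneg: "0 \<le> d x y" and gage_refl: "d x x = 0" and gage_sym: "d x y = d y x"
    and gage_triangle: "d x z \<le> d x y + d y z"
    and gage_bounded: "\<exists>B. \<forall>x y. d x y \<le> B"
    and gage_eventually: "\<epsilon> > 0 \<Longrightarrow> eventually (\<lambda>(x, y). d x y < \<epsilon>) uniformity"
  using assms by (auto simp: gage_def bounded_pseudometric_def)

lemma gageI:
  assumes "\<And>x y. 0 \<le> d x y" "\<And>x. d x x = 0" "\<And>x y. d x y = d y x"
    and "\<And>x y z. d x z \<le> d x y + d y z" "\<exists>B. \<forall>x y. d x y \<le> B"
    and "\<And>\<epsilon>. \<epsilon> > 0 \<Longrightarrow> eventually (\<lambda>(x, y). d x y < \<epsilon>) uniformity"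
  shows "d \<in> gage"
  using assms unfolding gage_def bounded_pseudometric_def by blast

lemma gage_zero: "(\<lambda>x y. 0) \<in> gage"
  by (rule gageI) (auto simp: case_prod_unfold)

lemma gage_add:
  assumes d: "d1 \<in> gage" "d2 \<in> gage"
  shows "(\<lambda>x y. d1 x y + d2 x y) \<in> gage"
proof -
  have "\<exists>B. \<forall>x y. d1 x y + d2 x y \<le> B"
    using d[THEN gage_bounded] by (meson add_mono)
  moreover have "eventually (\<lambda>(x, y). d1 x y + d2 x y < \<epsilon>) uniformity" if "\<epsilon> > 0" for \<epsilon>
    using gage_eventually[OF d(1), of "\<epsilon>/2"] gage_eventually[OF d(2), of "\<epsilon>/2"] that
    by (auto elim: eventually_elim2)
  moreover have "d1 x z + d2 x z \<le> d1 x y + d2 x y + (d1 y z + d2 y z)" for x y z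
    using gage_triangle[OF d(1), of x z y] gage_triangle[OF d(2), of x z y] by linarith
  moreover have "d1 x y + d2 x y = d1 y x + d2 y x" for x y
    using gage_sym[OF d(1), of x y] gage_sym[OF d(2), of x y] by simp
  ultimately show ?thesis
    by (intro gageI add_nonneg_nonneg d[THEN gage_nonneg]) (simp add: d[THEN gage_refl])
qed

lemma gage_scale:
  assumes d: "d \<in> gage" and c: "c \<ge> 0"
  shows "(\<lambda>x y. c * d x y) \<in> gage"
proof (cases "c = 0")
  case True
  then show ?thesis by (simp add: gage_zero)
next
  case False
  with c have c: "c > 0" by simp
  have "\<exists>B. \<forall>x y. c * d x y \<le> B"
    using gage_bounded[OF d] c by (meson mult_left_mono less_imp_le)
  moreover have "eventually (\<lambda>(x, y). c * d x y < \<epsilon>) uniformity" if "\<epsilon> > 0" for \<epsilon>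
    using gage_eventually[OF d, of "\<epsilon>/c"] that c by (simp add: field_simps)
  moreover have "c * d x z \<le> c * d x y + c * d y z" for x y z
    using gage_triangle[OF d, of x z y] c by (simp flip: distrib_left)
  moreover have "c * d x y = c * d y x" for x y
    using gage_sym[OF d, of x y] by (rule arg_cong)
  moreover have "0 \<le> c * d x y" "c * d x x = 0" for x y
    using c by (simp_all add: gage_nonneg[OF d] gage_refl[OF d])
  ultimately show ?thesis by (intro gageI)
qed

lemma gage_sum:
  assumes "\<And>i. i \<in> I \<Longrightarrow> d i \<in> gage"
  shows "(\<lambda>x y. \<Sum>i\<in>I. d i x y) \<in> gage"
  using assms
  by (induction I rule: infinite_finite_induct) (auto simp: gage_zero intro!: gage_add)

text \<open>The pseudo-metric axioms survive pointwise limits. Boundedness and the entourage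
  condition instead use a single \<open>u n\<close> that is uniformly close to
  \<open>d\<close>.\<close>

lemma gage_uniform_limit:
  assumes u: "\<And>n. u n \<in> gage"
    and lim: "uniform_limit UNIV (\<lambda>n (x, y). u n x y) (\<lambda>(x, y). d x y) sequentially"
  shows "d \<in> gage"
proof -
  have ptw: "(\<lambda>n. u n x y) \<longlonglongrightarrow> d x y" for x y
    using tendsto_uniform_limitI[OF lim, of "(x, y)"] by simp
  have near: "\<exists>n. \<forall>x y. \<bar>u n x y - d x y\<bar> < \<epsilon>" if "\<epsilon> > 0" for \<epsilon>
  proof -
    have "\<forall>\<^sub>F n in sequentially. \<forall>x y. \<bar>u n x y - d x y\<bar> < \<epsilon>"
      using uniform_limitD[OF lim that] by (simp add: dist_real_def)
    then show ?thesis by (rule eventually_happens'[rotated]) simp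
  qed
  have "0 \<le> d x y" for x y
    by (rule LIMSEQ_le_const[OF ptw]) (auto simp: gage_nonneg[OF u])
  moreover have "d x x = 0" for x
    using ptw[of x x] by (simp add: gage_refl[OF u] LIMSEQ_const_iff)
  moreover have "d x y = d y x" for x y
    using ptw[of x y] ptw[of y x] gage_sym[OF u, of _ x y] by (simp add: LIMSEQ_unique)
  moreover have "d x z \<le> d x y + d y z" for x y z
    by (rule LIMSEQ_le[OF ptw tendsto_add[OF ptw ptw]]) (auto simp: gage_triangle[OF u])
  moreover have "\<exists>B. \<forall>x y. d x y \<le> B"
  proof -
    obtain n where n: "\<And>x y. \<bar>u n x y - d x y\<bar> < 1" using near[of 1] by auto
    obtain B where B: "\<And>x y. u n x y \<le> B" using gage_bounded[OF u] by blast
    have "d x y \<le> B + 1" for x y using n[of x y] B[of x y] by linarith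
    then show ?thesis by blast
  qed
  moreover have "eventually (\<lambda>(x, y). d x y < \<epsilon>) uniformity" if pos: "\<epsilon> > 0" for \<epsilon>
  proof -
    obtain n where n: "\<And>x y. \<bar>u n x y - d x y\<bar> < \<epsilon>/2"
      using near[OF half_gt_zero[OF pos]] by blast
    have "eventually (\<lambda>(x, y). u n x y < \<epsilon>/2) uniformity"
      using pos by (intro gage_eventually[OF u]) simp
    then show ?thesis
    proof (rule eventually_mono)
      fix p assume "case p of (x, y) \<Rightarrow> u n x y < \<epsilon>/2"
      then show "case p of (x, y) \<Rightarrow> d x y < \<epsilon>"
        using n[of "fst p" "snd p"] unfolding split_beta by linarith
    qed
  qed
  ultimately show ?thesis by (rule gageI)
qed

text \<open>The partial sums lie in the gage, and the M-test with bounds \<open>c k\<close> makes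
  them converge uniformly.\<close>

lemma gage_suminf:
  assumes d: "\<And>k. d k \<in> gage" and le: "\<And>k x y. d k x y \<le> c k" and c: "summable c"
  shows "(\<lambda>x y. \<Sum>k. d k x y) \<in> gage"
proof (rule gage_uniform_limit)
  show "(\<lambda>x y. \<Sum>k<n. d k x y) \<in> gage" for n
    by (rule gage_sum) (rule d)
  show "uniform_limit UNIV (\<lambda>n (x, y). \<Sum>k<n. d k x y) (\<lambda>(x, y). \<Sum>k. d k x y) sequentially"
    unfolding split_beta by (rule Weierstrass_m_test[OF _ c]) (simp add: gage_nonneg[OF d] le)
qed

section \<open>Uniform continuity in terms of the gage\<close>

lemma uniformly_continuous_iff_eventually:
  fixes L :: "'a::uniform_space \<Rightarrow> real"
  shows "uniformly_continuous_on UNIV L \<longleftrightarrow>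
    (\<forall>\<epsilon>>0. eventually (\<lambda>(x, y). \<bar>L x - L y\<bar> < \<epsilon>) uniformity)"
proof (intro iffI allI impI)
  fix \<epsilon> :: real assume "uniformly_continuous_on UNIV L" "\<epsilon> > 0"
  then show "eventually (\<lambda>(x, y). \<bar>L x - L y\<bar> < \<epsilon>) uniformity"
    using uniformly_continuous_onD[of UNIV L "\<lambda>(x, y). dist x y < \<epsilon>"]
    by (auto simp: eventually_uniformity_metric dist_real_def)
next
  assume L: "\<forall>\<epsilon>>0. eventually (\<lambda>(x, y). \<bar>L x - L y\<bar> < \<epsilon>) uniformity"
  show "uniformly_continuous_on UNIV L"
    unfolding uniformly_continuous_on_uniformity filterlim_iff eventually_uniformity_metric
  proof (intro allI impI, elim exE conjE)
    fix P :: "real \<times> real \<Rightarrow> bool" and e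
    assume "0 < e" and P: "\<forall>x y. dist x y < e \<longrightarrow> P (x, y)"
    with L have "eventually (\<lambda>(x, y). \<bar>L x - L y\<bar> < e) uniformity" by blast
    then show "\<forall>\<^sub>F x in uniformity_on UNIV. P (case x of (x, y) \<Rightarrow> (L x, L y))"
      using P by (auto simp: dist_real_def elim!: eventually_mono)
  qed
qed

text \<open>For a bounded uniformly continuous \<open>L\<close>, the pseudo-metric
  \<open>\<bar>L x - L y\<bar>\<close> is itself a member of the gage.\<close>

lemma uniformly_continuous_iff_gage:
  fixes L :: "'a::uniform_space \<Rightarrow> real"
  assumes "bounded (range L)"
  shows "uniformly_continuous_on UNIV L \<longleftrightarrow> (\<exists>d\<in>gage. \<forall>x y. \<bar>L x - L y\<bar> \<le> d x y)"
proof
  assume uc: "uniformly_continuous_on UNIV L"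
  obtain B where B: "\<And>x. \<bar>L x\<bar> \<le> B" using assms by (auto simp: bounded_iff)
  have "\<bar>L x - L y\<bar> \<le> 2 * B" for x y using B[of x] B[of y] by linarith
  then have "\<exists>B. \<forall>x y. \<bar>L x - L y\<bar> \<le> B" by blast
  then have "(\<lambda>x y. \<bar>L x - L y\<bar>) \<in> gage"
    using uc unfolding uniformly_continuous_iff_eventually gage_def bounded_pseudometric_def by auto
  then show "\<exists>d\<in>gage. \<forall>x y. \<bar>L x - L y\<bar> \<le> d x y" by (rule bexI[rotated]) simp
next
  assume "\<exists>d\<in>gage. \<forall>x y. \<bar>L x - L y\<bar> \<le> d x y"
  then obtain d where d: "d \<in> gage" and le: "\<And>x y. \<bar>L x - L y\<bar> \<le> d x y" by blast
  show "uniformly_continuous_on UNIV L"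
    unfolding uniformly_continuous_iff_eventually
  proof (intro allI impI)
    fix \<epsilon> :: real assume "\<epsilon> > 0"
    from gage_eventually[OF d this] show "eventually (\<lambda>(x, y). \<bar>L x - L y\<bar> < \<epsilon>) uniformity"
      by (rule eventually_mono) (auto intro: le_less_trans[OF le])
  qed
qed

section \<open>Metrization: the gage generates the uniformity\<close>

text \<open>Two successive halvings, from \<open>E\<close> to \<open>P\<close> and from
  \<open>P\<close> to \<open>Q\<close>. Of three consecutive steps, two combine through
  \<open>Q\<close> into a \<open>P\<close> step, which combines with the third into
  \<open>E\<close>. Adding the reversed conditions makes \<open>D\<close> symmetric.\<close>

lemma uniformity_cube_refinement:
  fixes E :: "'a::uniform_space rel"
  assumes "eventually (\<lambda>p. p \<in> E) uniformity"
  obtains D where "eventually (\<lambda>p. p \<in> D) uniformity" "sym D" "D O D O D \<subseteq> E"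
proof -
  obtain P where P: "eventually P uniformity" "\<And>x y z. P (x, y) \<Longrightarrow> P (y, z) \<Longrightarrow> (x, z) \<in> E"
    using uniformity_transE[OF assms] by metis
  obtain Q where Q: "eventually Q uniformity" "\<And>x y z. Q (x, y) \<Longrightarrow> Q (y, z) \<Longrightarrow> P (x, z)"
    using uniformity_transE[OF P(1)] by metis
  define D where "D = {(x, y). (P (x, y) \<and> Q (x, y)) \<and> (P (y, x) \<and> Q (y, x))}"
  have PQ: "eventually (\<lambda>p. P p \<and> Q p) uniformity" using P(1) Q(1) by (rule eventually_conj)
  have "eventually (\<lambda>p. p \<in> D) uniformity"
    using eventually_conj[OF PQ uniformity_sym[OF PQ]]
    by (rule eventually_mono) (auto simp: D_def)
  moreover have "sym D" by (auto simp: D_def sym_def)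
  moreover have "D O D O D \<subseteq> E" unfolding D_def using P(2) Q(2) by blast
  ultimately show thesis by (rule that)
qed

text \<open>Chains with prescribed step sizes. Recording only the indices lets a chain be measured
  without naming its points.\<close>

primrec rel_list_comp :: "(nat \<Rightarrow> 'a rel) \<Rightarrow> nat list \<Rightarrow> 'a rel" where
  "rel_list_comp E [] = Id"
| "rel_list_comp E (n # ns) = E n O rel_list_comp E ns"

lemma rel_list_comp_append:
  "rel_list_comp E (ms @ ns) = rel_list_comp E ms O rel_list_comp E ns"
  by (induction ms) auto

lemma converse_rel_list_comp:
  assumes "\<And>n. sym (E n)"
  shows "(rel_list_comp E ns)\<inverse> = rel_list_comp E (rev ns)"
  using assms
  by (induction ns) (auto simp: rel_list_comp_append converse_relcomp sym_conv_converse_eq)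

text \<open>A step in \<open>E n\<close> is charged \<open>(1/2) ^ n\<close>; the infimum of these
  weights over chains becomes the metrizing pseudo-metric.\<close>

definition dyadic_weight :: "nat list \<Rightarrow> real" where
  "dyadic_weight ns = (\<Sum>n\<leftarrow>ns. (1/2) ^ n)"

lemma dyadic_weight_simps [simp]:
  "dyadic_weight [] = 0" "dyadic_weight (n # ns) = (1/2) ^ n + dyadic_weight ns"
  "dyadic_weight (ms @ ns) = dyadic_weight ms + dyadic_weight ns"
  "dyadic_weight (rev ns) = dyadic_weight ns"
  by (simp_all add: dyadic_weight_def flip: rev_map)

lemma dyadic_weight_nonneg: "dyadic_weight ns \<ge> 0"
  by (induction ns) auto

text \<open>An appended entry either leaves an earlier cut in place or is itself the entry that
  crosses \<open>t\<close>; \<open>t > 0\<close> excludes the empty list.\<close>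

lemma dyadic_weight_split:
  assumes "t > 0" "dyadic_weight ns \<ge> t"
  shows "\<exists>ms k ls. ns = ms @ k # ls \<and> dyadic_weight ms < t \<and> dyadic_weight (ms @ [k]) \<ge> t"
  using assms(2)
proof (induction ns rule: rev_induct)
  case Nil
  then show ?case using assms(1) by simp
next
  case (snoc n ns)
  show ?case
  proof (cases "dyadic_weight ns \<ge> t")
    case True
    then obtain ms k ls where "ns = ms @ k # ls" "dyadic_weight ms < t" "dyadic_weight (ms @ [k]) \<ge> t"
      using snoc.IH by blast
    then show ?thesis by (intro exI[of _ ms] exI[of _ k] exI[of _ "ls @ [n]"]) simp
  next
    case False
    with snoc.prems show ?thesis by (intro exI[of _ ns] exI[of _ n] exI[of _ "[]"]) auto
  qed
qed

text \<open>The chain is cut where its weight first reaches half of the bound \<open>(1/2) ^ n\<close>.\<close>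

lemma rel_list_comp_subset:
  assumes refl: "\<And>n. Id \<subseteq> E n" and cube: "\<And>n. E (Suc n) O E (Suc n) O E (Suc n) \<subseteq> E n"
    and "dyadic_weight ns < (1/2) ^ n"
  shows "rel_list_comp E ns \<subseteq> E n"
  using assms(3)
proof (induction "length ns" arbitrary: ns n rule: less_induct)
  case less
  have "E (Suc k) \<subseteq> E k" for k
  proof -
    have "Id O Id O E (Suc k) \<subseteq> E (Suc k) O E (Suc k) O E (Suc k)"
      by (intro relcomp_mono refl order_refl)
    then show ?thesis using cube[of k] by simp
  qed
  then have anti: "E l \<subseteq> E k" if "k \<le> l" for k l
    using that by (rule lift_Suc_antimono_le)
  have id: "Id \<subseteq> E (Suc n)" by (rule refl)
  show ?case
  proof (cases "dyadic_weight ns \<ge> (1/2) ^ Suc n")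
    case True
    obtain ms k ls where ns: "ns = ms @ k # ls" and ms: "dyadic_weight ms < (1/2) ^ Suc n"
      and mk: "dyadic_weight (ms @ [k]) \<ge> (1/2) ^ Suc n"
      using dyadic_weight_split[OF _ True] by auto
    \<comment> \<open>The prefix up to \<open>k\<close> already uses half of the bound, so less than
      the other half remains.\<close>
    have ls: "dyadic_weight ls < (1/2) ^ Suc n"
      using less.prems mk unfolding ns by simp
    \<comment> \<open>A single entry weighs less than the whole bound, so its index is at least
      \<open>Suc n\<close>.\<close>
    have "(1/2::real) ^ k < (1/2) ^ n"
      using less.prems dyadic_weight_nonneg[of ms] dyadic_weight_nonneg[of ls]
      unfolding ns dyadic_weight_simps by linarith
    then have "n < k" by (subst (asm) power_strict_decreasing_iff) auto
    then have "E k \<subseteq> E (Suc n)" by (intro anti) simp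
    moreover have "rel_list_comp E ms \<subseteq> E (Suc n)" "rel_list_comp E ls \<subseteq> E (Suc n)"
      using less.hyps[OF _ ms] less.hyps[OF _ ls] by (auto simp: ns)
    ultimately have "rel_list_comp E ns \<subseteq> E (Suc n) O E (Suc n) O E (Suc n)"
      unfolding ns rel_list_comp_append rel_list_comp.simps by (intro relcomp_mono)
    also have "\<dots> \<subseteq> E n" by (rule cube)
    finally show ?thesis .
  next
    case False
    show ?thesis
    proof (cases ns)
      case Nil
      then show ?thesis using refl by simp
    next
      case (Cons k ls)
      \<comment> \<open>The total stays below half of the bound. Since the induction is on the
        length, the head is split off to get a shorter list, and \<open>Id\<close> fills the third
        factor.\<close>
      have ls: "dyadic_weight ls < (1/2) ^ Suc n" and k: "(1/2::real) ^ k < (1/2) ^ n"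
        using False less.prems dyadic_weight_nonneg[of ls] zero_less_power[of "1/2::real" k]
        unfolding Cons dyadic_weight_simps by linarith+
      have "n < k" using k by (subst (asm) power_strict_decreasing_iff) auto
      then have "E k \<subseteq> E (Suc n)" by (intro anti) simp
      moreover have "rel_list_comp E ls \<subseteq> E (Suc n)"
        using less.hyps[OF _ ls] by (auto simp: Cons)
      ultimately have "rel_list_comp E ns \<subseteq> Id O E (Suc n) O E (Suc n)"
        unfolding Cons rel_list_comp.simps by auto
      also have "\<dots> \<subseteq> E (Suc n) O E (Suc n) O E (Suc n)"
        by (intro relcomp_mono id order_refl)
      also have "\<dots> \<subseteq> E n" by (rule cube)
      finally show ?thesis .
    qed
  qed
qed

text \<open>The distance \<open>d x y\<close> is the infimum of the weights of chains from
  \<open>x\<close> to \<open>y\<close>. A chain of weight below \<open>1/2\<close> stays in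
  \<open>V 1\<close>, hence in \<open>E\<close>.\<close>

lemma gage_generates_uniformity:
  fixes E :: "'a::uniform_space rel"
  assumes E: "eventually (\<lambda>p. p \<in> E) uniformity"
  obtains d \<epsilon> where "d \<in> gage" "\<epsilon> > 0" "{(x, y). d x y < \<epsilon>} \<subseteq> E"
proof -
  \<comment> \<open>\<open>V 0 = UNIV\<close> joins any two points by a chain of weight 1, so the
    infimum is over a nonempty set and \<open>d\<close> is bounded. Intersecting with
    \<open>E\<close> in the recursion yields \<open>V 1 \<subseteq> E\<close>.\<close>
  have "\<exists>V. \<forall>n. ((n = 0 \<longrightarrow> V n = UNIV) \<and> eventually (\<lambda>p. p \<in> V n) uniformity \<and> sym (V n)) \<and>
      (V (Suc n) O V (Suc n) O V (Suc n) \<subseteq> V n \<inter> E)"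
  proof (rule dependent_nat_choice)
    show "\<exists>V::'a rel. (0 = (0::nat) \<longrightarrow> V = UNIV) \<and> eventually (\<lambda>p. p \<in> V) uniformity \<and> sym V"
      by (intro exI[of _ UNIV]) (auto simp: sym_def)
  next
    fix V :: "'a rel" and n :: nat
    assume "(n = 0 \<longrightarrow> V = UNIV) \<and> eventually (\<lambda>p. p \<in> V) uniformity \<and> sym V"
    then have "eventually (\<lambda>p. p \<in> V \<inter> E) uniformity" using E by (simp add: eventually_conj)
    from uniformity_cube_refinement[OF this]
    show "\<exists>W. ((Suc n = 0 \<longrightarrow> W = UNIV) \<and> eventually (\<lambda>p. p \<in> W) uniformity \<and> sym W) \<and>
        W O W O W \<subseteq> V \<inter> E" by (metis nat.distinct(1))
  qed
  then obtain V :: "nat \<Rightarrow> 'a rel" where V0: "V 0 = UNIV"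
    and Vev: "\<And>n. eventually (\<lambda>p. p \<in> V n) uniformity" and Vsym: "\<And>n. sym (V n)"
    and Vcube: "\<And>n. V (Suc n) O V (Suc n) O V (Suc n) \<subseteq> V n \<inter> E" by metis
  have Vrefl: "Id \<subseteq> V n" for n
    using uniformity_refl[OF Vev] by auto
  have V1: "V 1 \<subseteq> E"
    using Vcube[of 0] Vrefl[of 1] by fastforce
  define d where "d x y = Inf (dyadic_weight ` {ns. (x, y) \<in> rel_list_comp V ns})" for x y
  have bdd: "bdd_below (dyadic_weight ` A)" for A
    by (rule bdd_belowI2[of _ 0]) (rule dyadic_weight_nonneg)
  have d_le: "d x y \<le> dyadic_weight ns" if "(x, y) \<in> rel_list_comp V ns" for x y ns
    unfolding d_def using that by (intro cINF_lower[OF bdd]) simp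
  have one: "(x, y) \<in> rel_list_comp V [0]" for x y by (simp add: V0)
  have d_ge: "t \<le> d x y" if "\<And>ns. (x, y) \<in> rel_list_comp V ns \<Longrightarrow> t \<le> dyadic_weight ns" for x y t
    unfolding d_def using that one[of x y] by (intro cINF_greatest) blast+
  have d_approx: "\<exists>ns. (x, y) \<in> rel_list_comp V ns \<and> dyadic_weight ns < t" if "d x y < t" for x y t
    using d_ge[of x y t] that by force
  have sym_le: "d x y \<le> d y x" for x y
  proof (rule d_ge)
    fix ns assume "(y, x) \<in> rel_list_comp V ns"
    then have "(x, y) \<in> rel_list_comp V (rev ns)"
      using converse_rel_list_comp[of V ns, OF Vsym] by blast
    from d_le[OF this] show "d x y \<le> dyadic_weight ns" by simp
  qed
  have tri: "d x z \<le> d x y + d y z" for x y z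
  proof -
    \<comment> \<open>The infimum is taken over the first chain with the second one fixed, and only
      afterwards over the second.\<close>
    have "d x z - dyadic_weight ns \<le> d x y" if ns: "(y, z) \<in> rel_list_comp V ns" for ns
    proof (rule d_ge)
      fix ms assume "(x, y) \<in> rel_list_comp V ms"
      with ns have "(x, z) \<in> rel_list_comp V (ms @ ns)" by (auto simp: rel_list_comp_append)
      from d_le[OF this] show "d x z - dyadic_weight ns \<le> dyadic_weight ms" by simp
    qed
    then have "d x z - d x y \<le> d y z" by (intro d_ge) force
    then show ?thesis by simp
  qed
  have nonneg: "0 \<le> d x y" for x y by (rule d_ge) (rule dyadic_weight_nonneg)
  have "d x x = 0" for x using d_le[of x x "[]"] nonneg[of x x] by simp
  moreover have "d x y \<le> 1" for x y using d_le[OF one] by simp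
  moreover have "eventually (\<lambda>(x, y). d x y < \<epsilon>) uniformity" if \<epsilon>: "\<epsilon> > 0" for \<epsilon>
  proof -
    obtain n where n: "(1/2) ^ n < \<epsilon>" using real_arch_pow_inv[OF \<epsilon>, of "1/2"] by auto
    have "d x y < \<epsilon>" if "(x, y) \<in> V n" for x y
      using d_le[of x y "[n]"] that n by auto
    then show ?thesis by (intro eventually_mono[OF Vev[of n]]) auto
  qed
  ultimately have "d \<in> gage"
    using nonneg sym_le tri unfolding gage_def bounded_pseudometric_def by (blast intro: antisym)
  moreover have "(x, y) \<in> E" if less: "d x y < 1/2" for x y
  proof -
    obtain ns where "(x, y) \<in> rel_list_comp V ns" "dyadic_weight ns < (1/2) ^ 1"
      using d_approx[OF less] by auto
    then show ?thesis using rel_list_comp_subset[of V ns 1] Vrefl Vcube V1 by blast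
  qed
  ultimately show thesis by (intro that[of d "1/2"]) auto
qed

text \<open>The one place where the Hausdorff property enters. The entourage restricts only pairs
  with first point \<open>x\<close>, and it omits \<open>(x, y)\<close>.\<close>

lemma gage_separates:
  fixes x y :: "'a::{uniform_space, t2_space}"
  assumes "x \<noteq> y"
  shows "\<exists>d\<in>gage. d x y > 0"
proof -
  obtain U where U: "open U" "x \<in> U" "y \<notin> U" using hausdorff[OF assms] by blast
  have "eventually (\<lambda>p. p \<in> {(u, v). u = x \<longrightarrow> v \<in> U}) uniformity"
    using bspec[OF U(1)[unfolded open_uniformity] U(2)] by (simp add: case_prod_unfold)
  then obtain d \<epsilon> where d: "d \<in> gage" "\<epsilon> > 0" "{(u, v). d u v < \<epsilon>} \<subseteq> {(u, v). u = x \<longrightarrow> v \<in> U}"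
    by (rule gage_generates_uniformity)
  with U(3) have "d x y > 0" by force
  with d(1) show ?thesis by blast
qed

section \<open>Barriers and the functions they dominate\<close>

lemma le_diam:
  assumes "d \<in> gage"
  shows "d x y \<le> diam d"
proof -
  obtain B where "\<And>x y. d x y \<le> B" using gage_bounded[OF assms] by blast
  then have "bdd_above (range (\<lambda>(x, y). d x y))" by (intro bdd_aboveI2[of _ _ B]) auto
  then have "(\<lambda>(x, y). d x y) (x, y) \<le> diam d" unfolding diam_def by (rule cSUP_upper[OF UNIV_I])
  then show ?thesis by simp
qed

lemma diam_nonneg: "d \<in> gage \<Longrightarrow> 0 \<le> diam d"
  using le_diam[of d undefined undefined] gage_nonneg[of d undefined undefined] by linarith

text \<open>Serves the empty relation, where a barrier is a multiple of the diameter.\<close>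

lemma diam_mono:
  assumes "d2 \<in> gage" "c \<ge> 0" "\<And>x y. d1 x y \<le> c * d2 x y"
  shows "diam d1 \<le> c * diam d2"
proof -
  have "d1 x y \<le> c * diam d2" for x y
    using assms(3)[of x y] mult_left_mono[OF le_diam[OF assms(1)] assms(2), of x y] by linarith
  then show ?thesis unfolding diam_def[of d1] by (intro cSUP_least) auto
qed

section \<open>Concatenation of chains and abstract barriers\<close>

definition chain_join :: "nat \<Rightarrow> (nat \<Rightarrow> 'a) \<Rightarrow> (nat \<Rightarrow> 'a) \<Rightarrow> nat \<Rightarrow> 'a" where
  "chain_join n a a' i = (if i \<le> n then a i else a' (i - n))"

lemma is_chain_join:
  assumes "is_chain f m a b" "is_chain f n a' b'"
  shows "is_chain f (m + n) (chain_join m a a') (chain_join m b b')"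
  using assms unfolding is_chain_def chain_join_def
  by (auto simp: not_le)

text \<open>The interface through which both parts of the theorem are proved at once. The factor
  \<open>c\<close> in \<open>mono\<close> combines monotonicity with homogeneity; the last two
  conditions replace one barrier term by a plain distance.\<close>

locale gage_barrier =
  fixes g :: "('a::uniform_space \<Rightarrow> 'a \<Rightarrow> real) \<Rightarrow> 'a \<Rightarrow> 'a \<Rightarrow> real"
  assumes nonneg: "d \<in> gage \<Longrightarrow> 0 \<le> g d x y"
    and mono: "d1 \<in> gage \<Longrightarrow> d2 \<in> gage \<Longrightarrow> c > 0 \<Longrightarrow> (\<And>x y. d1 x y \<le> c * d2 x y) \<Longrightarrow>
      g d1 x y \<le> c * g d2 x y"
    and triangle: "d \<in> gage \<Longrightarrow> g d x z \<le> g d x y + g d y z"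
    and triangle_right: "d \<in> gage \<Longrightarrow> g d x z \<le> g d x y + d y z"
    and triangle_left: "d \<in> gage \<Longrightarrow> g d x z \<le> d x y + g d y z"

text \<open>Each property of the infimum is inherited from the cost of single chains. The factor
  \<open>e\<close> encodes the convention for \<open>f = {}\<close>, which is settled by the
  diameter being nonnegative and monotone.\<close>

lemma gage_barrier_chain_Inf:
  fixes f :: "'a::uniform_space rel"
    and cost :: "('a \<Rightarrow> 'a \<Rightarrow> real) \<Rightarrow> 'a \<Rightarrow> 'a \<Rightarrow> nat \<Rightarrow> (nat \<Rightarrow> 'a) \<Rightarrow> (nat \<Rightarrow> 'a) \<Rightarrow> real"
  assumes g: "\<And>d x y. g d x y = (if f = {} then e * diam d
      else Inf {cost d x y n a b | n a b. is_chain f n a b})"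
    and e: "e \<ge> 0"
    and nonneg: "\<And>d x y n a b. d \<in> gage \<Longrightarrow> 0 \<le> cost d x y n a b"
    and mono: "\<And>d1 d2 c x y n a b. d1 \<in> gage \<Longrightarrow> d2 \<in> gage \<Longrightarrow> c > 0 \<Longrightarrow>
      (\<And>x y. d1 x y \<le> c * d2 x y) \<Longrightarrow> cost d1 x y n a b \<le> c * cost d2 x y n a b"
    and join: "\<And>d x y z m a b n a' b'. d \<in> gage \<Longrightarrow> m \<ge> 1 \<Longrightarrow> n \<ge> 1 \<Longrightarrow>
      cost d x z (m + n) (chain_join m a a') (chain_join m b b') \<le> cost d x y m a b + cost d y z n a' b'"
    and right: "\<And>d x y z n a b. d \<in> gage \<Longrightarrow> cost d x z n a b \<le> cost d x y n a b + d y z"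
    and left: "\<And>d x y z n a b. d \<in> gage \<Longrightarrow> cost d x z n a b \<le> d x y + cost d y z n a b"
  shows "gage_barrier g"
proof (cases "f = {}")
  case True
  then have g': "g d x y = e * diam d" for d x y by (simp add: g)
  have "0 \<le> e * diam d" if "d \<in> gage" for d :: "'a \<Rightarrow> 'a \<Rightarrow> real"
    using e diam_nonneg[OF that] by simp
  moreover have "e * diam d1 \<le> c * (e * diam d2)"
    if "d2 \<in> gage" "c > 0" "\<And>x y. d1 x y \<le> c * d2 x y" for d1 d2 :: "'a \<Rightarrow> 'a \<Rightarrow> real" and c
    using mult_left_mono[OF diam_mono[OF that(1) less_imp_le[OF that(2)] that(3)] e]
    by (simp add: mult_ac)
  ultimately show ?thesis
    by unfold_locales (simp_all add: g' gage_nonneg)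
next
  case False
  then obtain u v where "(u, v) \<in> f" by auto
  \<comment> \<open>This one-step chain keeps the set under the infimum nonempty.\<close>
  then have chain: "is_chain f 1 (\<lambda>_. u) (\<lambda>_. v)" by (auto simp: is_chain_def)
  have g': "g d x y = Inf {cost d x y n a b | n a b. is_chain f n a b}" for d x y
    using False by (simp add: g)
  have le: "g d x y \<le> cost d x y n a b" if "d \<in> gage" "is_chain f n a b" for d x y n a b
    unfolding g' using that nonneg[OF that(1)]
    by (intro cInf_lower bdd_belowI[of _ 0]) auto
  have ge: "t \<le> g d x y" if "\<And>n a b. is_chain f n a b \<Longrightarrow> t \<le> cost d x y n a b" for t d x y
    unfolding g' using chain that by (intro cInf_greatest) auto
  show ?thesis
  proof
    fix d :: "'a \<Rightarrow> 'a \<Rightarrow> real" and x y z assume d: "d \<in> gage"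
    show "0 \<le> g d x y" by (rule ge) (rule nonneg[OF d])
    show "g d x z \<le> g d x y + d y z"
    proof -
      \<comment> \<open>With the distance moved to the left, the claim is a lower bound for an
        infimum and can be checked chain by chain.\<close>
      have "g d x z - d y z \<le> g d x y"
      proof (rule ge)
        fix n a b assume "is_chain f n a b"
        then show "g d x z - d y z \<le> cost d x y n a b"
          using le[OF d, of n a b x z] right[OF d, of x z n a b y] by linarith
      qed
      then show ?thesis by simp
    qed
    show "g d x z \<le> d x y + g d y z"
    proof -
      have "g d x z - d x y \<le> g d y z"
      proof (rule ge)
        fix n a b assume "is_chain f n a b"
        then show "g d x z - d x y \<le> cost d y z n a b"
          using le[OF d, of n a b x z] left[OF d, of x z n a b y] by linarith
      qed
      then show ?thesis by simp
    qed
    \<comment> \<open>The two infima on the right of the triangle inequality are taken one after the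
      other; joining the chains gives the estimate.\<close>
    have "g d x z - cost d y z n a' b' \<le> g d x y" if n: "is_chain f n a' b'" for n a' b'
    proof (rule ge)
      fix m a b assume m: "is_chain f m a b"
      show "g d x z - cost d y z n a' b' \<le> cost d x y m a b"
        using le[OF d is_chain_join[OF m n], of x z] join[OF d, of m n x z a a' b b' y] m n
        by (simp add: is_chain_def)
    qed
    then have "g d x z - g d x y \<le> g d y z" by (intro ge) (simp add: algebra_simps)
    then show "g d x z \<le> g d x y + g d y z" by simp
  next
    fix d1 d2 :: "'a \<Rightarrow> 'a \<Rightarrow> real" and c x y
    assume *: "d1 \<in> gage" "d2 \<in> gage" "c > 0" "\<And>x y. d1 x y \<le> c * d2 x y"
    \<comment> \<open>Dividing by \<open>c\<close> leaves a bare infimum on the right.\<close>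
    have "g d1 x y / c \<le> g d2 x y"
    proof (rule ge)
      fix n a b assume "is_chain f n a b"
      with le[OF *(1) this, of x y] mono[OF *, of x y n a b]
      show "g d1 x y / c \<le> cost d2 x y n a b"
        using *(3) by (simp add: pos_divide_le_eq mult.commute)
    qed
    then show "g d1 x y \<le> c * g d2 x y" using *(3) by (simp add: pos_divide_le_eq mult.commute)
  qed
qed

section \<open>The two barriers as instances\<close>

lemma gage_barrier_l:
  fixes f :: "'a::uniform_space rel"
  shows "gage_barrier (\<lambda>d. barrier_l d f)"
proof (rule gage_barrier_chain_Inf[where e = 2 and f = f and
      cost = "\<lambda>d x y n a b. d x (a 1) + (\<Sum>i=1..<n. d (b i) (a (i + 1))) + d (b n) y"])
  fix d :: "'a \<Rightarrow> 'a \<Rightarrow> real" and x y z and n :: nat and a b :: "nat \<Rightarrow> 'a" assume d: "d \<in> gage"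
  show "0 \<le> d x (a 1) + (\<Sum>i=1..<n. d (b i) (a (i + 1))) + d (b n) y"
    by (intro add_nonneg_nonneg sum_nonneg gage_nonneg[OF d])
  show "d x (a 1) + (\<Sum>i=1..<n. d (b i) (a (i + 1))) + d (b n) z
      \<le> d x (a 1) + (\<Sum>i=1..<n. d (b i) (a (i + 1))) + d (b n) y + d y z"
    using gage_triangle[OF d, of "b n" z y] by simp
  show "d x (a 1) + (\<Sum>i=1..<n. d (b i) (a (i + 1))) + d (b n) z
      \<le> d x y + (d y (a 1) + (\<Sum>i=1..<n. d (b i) (a (i + 1))) + d (b n) z)"
    using gage_triangle[OF d, of x "a 1" y] by simp
next
  fix d1 d2 :: "'a \<Rightarrow> 'a \<Rightarrow> real" and c x y and n :: nat and a b :: "nat \<Rightarrow> 'a"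
  assume le: "\<And>x y. d1 x y \<le> c * d2 x y"
  show "d1 x (a 1) + (\<Sum>i=1..<n. d1 (b i) (a (i + 1))) + d1 (b n) y
      \<le> c * (d2 x (a 1) + (\<Sum>i=1..<n. d2 (b i) (a (i + 1))) + d2 (b n) y)"
    unfolding distrib_left sum_distrib_left by (intro add_mono sum_mono le)
next
  fix d :: "'a \<Rightarrow> 'a \<Rightarrow> real" and x y z and m n :: nat and a b a' b' :: "nat \<Rightarrow> 'a"
  assume d: "d \<in> gage" and m: "m \<ge> 1" and n: "n \<ge> 1"
  let ?t = "\<lambda>i. d (chain_join m b b' i) (chain_join m a a' (i + 1))"
  \<comment> \<open>The joined sum consists of the links of the first chain, the junction
    \<open>?t m\<close>, and the shifted links of the second chain. The junction replaces the two
    end terms at \<open>y\<close> by the triangle inequality.\<close>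
  have "(\<Sum>i=1..<m + n. ?t i) = (\<Sum>i=1..<m. ?t i) + (\<Sum>i=m..<m + n. ?t i)"
    using m by (intro sum.atLeastLessThan_concat[symmetric]) auto
  also have "(\<Sum>i=m..<m + n. ?t i) = ?t m + (\<Sum>i=Suc m..<m + n. ?t i)"
    using n by (intro sum.atLeast_Suc_lessThan) simp
  also have "(\<Sum>i=Suc m..<m + n. ?t i) = (\<Sum>i=1..<n. ?t (i + m))"
    using sum.shift_bounds_nat_ivl[of ?t 1 m n] by (simp add: add.commute)
  also have "\<dots> = (\<Sum>i=1..<n. d (b' i) (a' (i + 1)))"
    by (intro sum.cong) (auto simp: chain_join_def Suc_diff_le)
  also have "(\<Sum>i=1..<m. ?t i) = (\<Sum>i=1..<m. d (b i) (a (i + 1)))"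
    by (intro sum.cong) (auto simp: chain_join_def)
  also have "?t m = d (b m) (a' 1)" by (simp add: chain_join_def)
  finally show "d x (chain_join m a a' 1) + (\<Sum>i=1..<m + n. ?t i) + d (chain_join m b b' (m + n)) z
      \<le> d x (a 1) + (\<Sum>i=1..<m. d (b i) (a (i + 1))) + d (b m) y +
        (d y (a' 1) + (\<Sum>i=1..<n. d (b' i) (a' (i + 1))) + d (b' n) z)"
    using gage_triangle[OF d, of "b m" "a' 1" y] m n by (simp add: chain_join_def)
qed (simp_all add: barrier_l_def)

definition max_cost ::
    "('a \<Rightarrow> 'a \<Rightarrow> real) \<Rightarrow> 'a \<Rightarrow> 'a \<Rightarrow> nat \<Rightarrow> (nat \<Rightarrow> 'a) \<Rightarrow> (nat \<Rightarrow> 'a) \<Rightarrow> real" where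
  "max_cost d x y n a b =
     Max ({d x (a 1)} \<union> (\<lambda>i. d (b i) (a (i + 1))) ` {1..<n} \<union> {d (b n) y})"

lemma max_cost_le_iff:
  "max_cost d x y n a b \<le> t \<longleftrightarrow>
     d x (a 1) \<le> t \<and> (\<forall>i\<in>{1..<n}. d (b i) (a (i + 1)) \<le> t) \<and> d (b n) y \<le> t"
  unfolding max_cost_def by (subst Max_le_iff) auto

lemma le_max_cost:
  "d x (a 1) \<le> max_cost d x y n a b" "d (b n) y \<le> max_cost d x y n a b"
  "1 \<le> i \<Longrightarrow> i < n \<Longrightarrow> d (b i) (a (Suc i)) \<le> max_cost d x y n a b"
  using max_cost_le_iff[of d x y n a b "max_cost d x y n a b"] by auto

lemma gage_barrier_m:
  fixes f :: "'a::uniform_space rel"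
  shows "gage_barrier (\<lambda>d. barrier_m d f)"
proof (rule gage_barrier_chain_Inf[where e = 1 and f = f and cost = max_cost])
  fix d :: "'a \<Rightarrow> 'a \<Rightarrow> real" and x y z and n :: nat and a b :: "nat \<Rightarrow> 'a" assume d: "d \<in> gage"
  show "0 \<le> max_cost d x y n a b"
    by (rule order_trans[OF gage_nonneg[OF d] le_max_cost(1)[where d = d]])
  note le = le_max_cost[where d = d and a = a and b = b and n = n]
  show "max_cost d x z n a b \<le> max_cost d x y n a b + d y z"
    unfolding max_cost_le_iff
    using gage_triangle[OF d, of "b n" z y] gage_nonneg[OF d, of y z] le[where x = x and y = y]
    by (auto intro: add_increasing2)
  show "max_cost d x z n a b \<le> d x y + max_cost d y z n a b"
    unfolding max_cost_le_iff
    using gage_triangle[OF d, of x "a 1" y] gage_nonneg[OF d, of x y] le[where x = y and y = z]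
    by (auto intro: add_increasing)
next
  fix d1 d2 :: "'a \<Rightarrow> 'a \<Rightarrow> real" and c :: real and x y and n :: nat and a b :: "nat \<Rightarrow> 'a"
  assume c: "c > 0" and le: "\<And>x y. d1 x y \<le> c * d2 x y"
  have "d1 u v \<le> c * t" if "d2 u v \<le> t" for u v t
    using le[of u v] mult_left_mono[OF that less_imp_le[OF c]] by linarith
  then show "max_cost d1 x y n a b \<le> c * max_cost d2 x y n a b"
    unfolding max_cost_le_iff by (simp add: le_max_cost[simplified])
next
  fix d :: "'a \<Rightarrow> 'a \<Rightarrow> real" and x y z and m n :: nat and a b a' b' :: "nat \<Rightarrow> 'a"
  assume d: "d \<in> gage" and m: "m \<ge> 1" and n: "n \<ge> 1"
  let ?M = "max_cost d x y m a b" and ?N = "max_cost d y z n a' b'"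
  note M = le_max_cost[where d = d and x = x and y = y and a = a and b = b and n = m]
    and N = le_max_cost[where d = d and x = y and y = z and a = a' and b = b' and n = n]
  have M0: "0 \<le> ?M" and N0: "0 \<le> ?N"
    by (rule order_trans[OF gage_nonneg[OF d] le_max_cost(1)[where d = d]])+
  \<comment> \<open>A link inside one chain costs at most \<open>?M\<close> or \<open>?N\<close>;
    the junction \<open>i = m\<close> is estimated through \<open>y\<close> and uses both.\<close>
  have "d (chain_join m b b' i) (chain_join m a a' (i + 1)) \<le> ?M + ?N"
    if i: "i \<in> {1..<m + n}" for i
  proof -
    consider "i < m" | "i = m" | "i > m" by linarith
    then show ?thesis
    proof cases
      case 1
      then show ?thesis using M(3)[of i] N0 i by (simp add: chain_join_def)
    next
      case 2
      then show ?thesis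
        using gage_triangle[OF d, of "b m" "a' 1" y] M(2) N(1) by (simp add: chain_join_def)
    next
      case 3
      then have "1 \<le> i - m" "i - m < n" using i by auto
      from N(3)[OF this] show ?thesis using M0 3 by (simp add: chain_join_def Suc_diff_le)
    qed
  qed
  then show "max_cost d x z (m + n) (chain_join m a a') (chain_join m b b') \<le> ?M + ?N"
    unfolding max_cost_le_iff using M(1) N(2) M0 N0 m n by (auto simp: chain_join_def)
qed (simp_all add: barrier_m_def max_cost_def)

section \<open>Functions dominated by an abstract barrier\<close>

context gage_barrier
begin

definition lyap :: "('a \<Rightarrow> real) set" where
  "lyap = {L. bounded (range L) \<and> uniformly_continuous_on UNIV L \<and>
              (\<exists>d\<in>gage. \<exists>K>0. dominated_by K (g d) L)}"

definition zero_rel :: "'a rel" where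
  "zero_rel = (\<Inter>d\<in>gage. {(x, y). g d x y = 0})"

lemma mono1:
  assumes "d1 \<in> gage" "d2 \<in> gage" "\<And>x y. d1 x y \<le> d2 x y"
  shows "g d1 x y \<le> g d2 x y"
  using mono[OF assms(1,2), of 1] assms(3) by simp

text \<open>Apply \<open>mono\<close> with factor \<open>1/c\<close> to \<open>d\<close> and its
  multiple by \<open>c\<close>. For \<open>c = 0\<close> only nonnegativity is involved.\<close>

lemma mult_le_scale:
  assumes d: "d \<in> gage" and c: "c \<ge> 0"
  shows "c * g d x y \<le> g (\<lambda>x y. c * d x y) x y"
proof (cases "c = 0")
  case True
  then show ?thesis using nonneg[OF gage_zero] by simp
next
  case False
  with c have "c > 0" by simp
  then show ?thesis
    using mono[OF d gage_scale[OF d c], of "1/c" x y] by (simp add: field_simps)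
qed

lemma lyapI:
  assumes "bounded (range L)" "d \<in> gage" "\<And>x y. \<bar>L x - L y\<bar> \<le> d x y" "\<And>x y. L x - L y \<le> g d x y"
  shows "L \<in> lyap"
proof -
  have "dominated_by 1 (g d) L" using assms(4) by (simp add: dominated_by_def)
  moreover have "uniformly_continuous_on UNIV L"
    using assms(2,3) uniformly_continuous_iff_gage[OF assms(1)] by blast
  ultimately show ?thesis unfolding lyap_def using assms(1,2) zero_less_one by blast
qed

lemma lyapE:
  assumes "L \<in> lyap"
  obtains d where "d \<in> gage" "\<And>x y. \<bar>L x - L y\<bar> \<le> d x y" "\<And>x y. L x - L y \<le> g d x y"
proof -
  from assms obtain d1 d2 K where d1: "d1 \<in> gage" "\<And>x y. \<bar>L x - L y\<bar> \<le> d1 x y"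
    and d2: "d2 \<in> gage" "K > 0" "\<And>x y. L x - L y \<le> K * g d2 x y"
    unfolding lyap_def dominated_by_def using uniformly_continuous_iff_gage by blast
  \<comment> \<open>\<open>d1\<close> controls the oscillation of \<open>L\<close> and
    \<open>K * d2\<close> absorbs the constant \<open>K\<close>; the sum dominates both.\<close>
  define d where "d = (\<lambda>x y. d1 x y + K * d2 x y)"
  have Kd2: "(\<lambda>x y. K * d2 x y) \<in> gage" using d2 by (intro gage_scale) auto
  have d: "d \<in> gage" unfolding d_def by (intro gage_add d1 Kd2)
  show thesis
  proof (rule that[OF d])
    fix x y
    show "\<bar>L x - L y\<bar> \<le> d x y"
      using d1(2)[of x y] gage_nonneg[OF Kd2, of x y] by (simp add: d_def)
    have "g (\<lambda>x y. K * d2 x y) x y \<le> g d x y"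
      by (rule mono1[OF Kd2 d]) (simp add: d_def gage_nonneg[OF d1(1)])
    then show "L x - L y \<le> g d x y"
      using d2(3)[of x y] mult_le_scale[OF d2(1), of K x y] d2(2) by linarith
  qed
qed

lemma lyap_bounded: "L \<in> lyap \<Longrightarrow> bounded (range L)"
  by (simp add: lyap_def)

lemma lyap_le_rel:
  assumes "L \<in> lyap"
  shows "zero_rel \<subseteq> le_rel L"
proof (rule subrelI)
  fix x y assume xy: "(x, y) \<in> zero_rel"
  obtain d where d: "d \<in> gage" and le: "\<And>x y. L x - L y \<le> g d x y"
    by (rule lyapE[OF assms]) (rule that)
  from d xy have "g d x y = 0" by (auto simp: zero_rel_def)
  with le[of x y] show "(x, y) \<in> le_rel L" by (simp add: le_rel_def)
qed

lemma lyap_lyapunov_function: "L \<in> lyap \<Longrightarrow> lyapunov_function zero_rel L"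
  using lyap_le_rel
  by (auto simp: lyapunov_function_def lyap_def intro: uniformly_continuous_imp_continuous)

lemma ALG_lyap: "ALG lyap"
proof -
  have const: "(\<lambda>x. c) \<in> lyap" for c
    by (rule lyapI[OF _ gage_zero]) (auto simp: nonneg[OF gage_zero])
  have scale: "(\<lambda>x. c * L x) \<in> lyap" if L: "L \<in> lyap" and c: "c \<ge> 0" for c L
  proof -
    obtain d where d: "d \<in> gage" "\<And>x y. \<bar>L x - L y\<bar> \<le> d x y" "\<And>x y. L x - L y \<le> g d x y"
      by (rule lyapE[OF L]) (rule that)
    show ?thesis
    proof (rule lyapI)
      show "bounded (range (\<lambda>x. c * L x))"
        using bounded_scaling[OF lyap_bounded[OF L], of c] by (simp add: image_image)
      show "(\<lambda>x y. c * d x y) \<in> gage" by (rule gage_scale[OF d(1) c])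
      fix x y
      show "\<bar>c * L x - c * L y\<bar> \<le> c * d x y"
        using mult_left_mono[OF d(2) c] c by (simp flip: right_diff_distrib add: abs_mult)
      show "c * L x - c * L y \<le> g (\<lambda>x y. c * d x y) x y"
        using mult_left_mono[OF d(3)[of x y] c] mult_le_scale[OF d(1) c, of x y]
        by (simp add: right_diff_distrib)
    qed
  qed
  have add_max_min: "(\<lambda>x. L1 x + L2 x) \<in> lyap" "(\<lambda>x. max (L1 x) (L2 x)) \<in> lyap"
    "(\<lambda>x. min (L1 x) (L2 x)) \<in> lyap" if L: "L1 \<in> lyap" "L2 \<in> lyap" for L1 L2
  proof -
    obtain B1 B2 where B: "\<And>x. \<bar>L1 x\<bar> \<le> B1" "\<And>x. \<bar>L2 x\<bar> \<le> B2"
      using L[THEN lyap_bounded] by (auto simp: bounded_iff)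
    obtain d1 where d1: "d1 \<in> gage" "\<And>x y. \<bar>L1 x - L1 y\<bar> \<le> d1 x y" "\<And>x y. L1 x - L1 y \<le> g d1 x y"
      by (rule lyapE[OF L(1)]) (rule that)
    obtain d2 where d2: "d2 \<in> gage" "\<And>x y. \<bar>L2 x - L2 y\<bar> \<le> d2 x y" "\<And>x y. L2 x - L2 y \<le> g d2 x y"
      by (rule lyapE[OF L(2)]) (rule that)
    \<comment> \<open>The factors 2 make up for \<open>g\<close> not being assumed superadditive:
      \<open>g d\<close> dominates \<open>2 * g d1\<close> and \<open>2 * g d2\<close> separately,
      hence their average \<open>g d1 + g d2\<close>.\<close>
    define d where "d = (\<lambda>x y. 2 * d1 x y + 2 * d2 x y)"
    have d: "d \<in> gage" unfolding d_def by (intro gage_scale gage_add d1 d2) simp_all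
    have n: "0 \<le> d1 x y" "0 \<le> d2 x y" "0 \<le> g d1 x y" "0 \<le> g d2 x y" for x y
      using d1(1) d2(1) by (auto intro: gage_nonneg nonneg)
    have g1: "2 * g d1 x y \<le> g d x y" and g2: "2 * g d2 x y \<le> g d x y" for x y
      using mono[OF d1(1) d, of "1/2" x y] mono[OF d2(1) d, of "1/2" x y] n by (auto simp: d_def)
    show "(\<lambda>x. L1 x + L2 x) \<in> lyap"
    proof (rule lyapI[OF _ d])
      show "bounded (range (\<lambda>x. L1 x + L2 x))"
        using B unfolding bounded_iff by (intro exI[of _ "B1 + B2"]) (smt (verit) imageE real_norm_def)
      fix x y
      show "\<bar>L1 x + L2 x - (L1 y + L2 y)\<bar> \<le> d x y"
        using d1(2)[of x y] d2(2)[of x y] n[of x y] unfolding d_def by linarith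
      show "L1 x + L2 x - (L1 y + L2 y) \<le> g d x y"
        using d1(3)[of x y] d2(3)[of x y] g1[of x y] g2[of x y] by linarith
    qed
    show "(\<lambda>x. max (L1 x) (L2 x)) \<in> lyap"
    proof (rule lyapI[OF _ d])
      show "bounded (range (\<lambda>x. max (L1 x) (L2 x)))"
        using B unfolding bounded_iff by (intro exI[of _ "B1 + B2"]) (smt (verit) imageE real_norm_def)
      fix x y
      show "\<bar>max (L1 x) (L2 x) - max (L1 y) (L2 y)\<bar> \<le> d x y"
        using d1(2)[of x y] d2(2)[of x y] n[of x y] unfolding d_def by linarith
      \<comment> \<open>A difference of maxima is at most the larger of the two differences, and
        \<open>g d1\<close> and \<open>g d2\<close> are both below \<open>g d\<close>.\<close>
      show "max (L1 x) (L2 x) - max (L1 y) (L2 y) \<le> g d x y"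
        using d1(3)[of x y] d2(3)[of x y] g1[of x y] g2[of x y] n[of x y] by linarith
    qed
    show "(\<lambda>x. min (L1 x) (L2 x)) \<in> lyap"
    proof (rule lyapI[OF _ d])
      show "bounded (range (\<lambda>x. min (L1 x) (L2 x)))"
        using B unfolding bounded_iff by (intro exI[of _ "B1 + B2"]) (smt (verit) imageE real_norm_def)
      fix x y
      show "\<bar>min (L1 x) (L2 x) - min (L1 y) (L2 y)\<bar> \<le> d x y"
        using d1(2)[of x y] d2(2)[of x y] n[of x y] unfolding d_def by linarith
      show "min (L1 x) (L2 x) - min (L1 y) (L2 y) \<le> g d x y"
        using d1(3)[of x y] d2(3)[of x y] g1[of x y] g2[of x y] n[of x y] by linarith
    qed
  qed
  show ?thesis unfolding ALG_def by (intro ballI allI impI conjI add_max_min scale const)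
qed

text \<open>
  The weights \<open>w k\<close> make \<open>D = \<Sum>k. w k * d k\<close> converge; the extra factor \<open>(1/2) ^ k\<close> in
  \<open>a k\<close> is needed because \<open>g\<close> need not be superadditive in \<open>d\<close>, so that only the termwise
  bounds \<open>w k * g (d k) \<le> g D\<close> are available.
\<close>

lemma CON_lyap: "CON lyap"
  unfolding CON_def
proof (intro allI impI)
  fix L :: "nat \<Rightarrow> 'a \<Rightarrow> real" assume L: "\<forall>k. L k \<in> lyap"
  have "\<exists>d. d \<in> gage \<and> (\<forall>x y. \<bar>L k x - L k y\<bar> \<le> d x y) \<and> (\<forall>x y. L k x - L k y \<le> g d x y)" for k
    using lyapE[of "L k"] L by metis
  then obtain d where d: "\<And>k. d k \<in> gage" "\<And>k x y. \<bar>L k x - L k y\<bar> \<le> d k x y"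
    "\<And>k x y. L k x - L k y \<le> g (d k) x y" by metis
  obtain B where B: "\<And>k x y. d k x y \<le> B k" using gage_bounded[OF d(1)] by metis
  have "\<exists>M. \<forall>x. \<bar>L k x\<bar> \<le> M" for k using lyap_bounded[of "L k"] L by (auto simp: bounded_iff)
  then obtain M where M: "\<And>k x. \<bar>L k x\<bar> \<le> M k" by metis
  have B0: "0 \<le> B k" for k using B[of k] gage_nonneg[OF d(1)] order_trans by blast
  have M0: "0 \<le> M k" for k using M[of k] abs_ge_zero order_trans by blast
  define h :: "nat \<Rightarrow> real" where "h k = (1/2) ^ k" for k
  have h: "summable h" "\<And>k. 0 < h k" "\<And>k. h k \<le> 1" "suminf h = 2"
    using suminf_geometric[of "1/2::real"] unfolding h_def by (auto simp: power_le_one summable_geometric)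
  \<comment> \<open>The denominator bounds both \<open>w k * B k\<close> and
    \<open>w k * M k\<close> by \<open>h k\<close>, so one weight serves the series of
    pseudo-metrics and that of functions; the summand 1 keeps it positive.\<close>
  define w where "w k = h k / (1 + B k + M k)" for k
  define a where "a k = h k * w k" for k
  have pos: "0 < 1 + B k + M k" for k using B0[of k] M0[of k] by linarith
  have w: "0 < w k" "w k \<le> h k" "w k * B k \<le> h k" "w k * M k \<le> h k" for k
    using h(2)[of k] pos[of k] B0[of k] M0[of k] by (auto simp: w_def field_simps)
  have a: "0 < a k" "a k \<le> w k" "a k \<le> h k" for k
    using h(2,3)[of k] w(1,2)[of k] by (auto simp: a_def intro: mult_left_le_one_le order_trans[of _ "w k"])
  define D where "D = (\<lambda>x y. \<Sum>k. w k * d k x y)"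
  have wd: "w k * d k x y \<le> h k" for k x y
    using mult_left_mono[OF B[of k x y] less_imp_le[OF w(1)[of k]]] w(3)[of k] by linarith
  have wd_gage: "(\<lambda>x y. w k * d k x y) \<in> gage" for k
    by (intro gage_scale d less_imp_le[OF w(1)])
  have D: "D \<in> gage" unfolding D_def by (rule gage_suminf[OF wd_gage wd h(1)])
  have wd_summable: "summable (\<lambda>k. w k * d k x y)" for x y
    by (rule summable_comparison_test'[OF h(1), of 0]) (simp add: wd gage_nonneg[OF wd_gage])
  have wd_le_D: "w k * d k x y \<le> D x y" for k x y
    using sum_le_suminf[OF wd_summable, of "{k}" x y] gage_nonneg[OF wd_gage] by (simp add: D_def)
  have wg: "w k * g (d k) x y \<le> g D x y" for k x y
    using mult_le_scale[OF d(1)[of k] less_imp_le[OF w(1)[of k]], of x y]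
      mono1[OF wd_gage D wd_le_D, of k x y] by linarith
  have aL: "\<bar>a k * L k x\<bar> \<le> h k" for k x
  proof -
    have "\<bar>a k * L k x\<bar> \<le> w k * M k"
      using a(1,2)[of k] M[of k x] by (auto simp: abs_mult intro!: mult_mono)
    then show ?thesis using w(4)[of k] by linarith
  qed
  have aL_summable: "summable (\<lambda>k. a k * L k x)" for x
    by (rule summable_comparison_test'[OF h(1), of 0]) (simp add: aL)
  define S where "S x = (\<Sum>k. a k * L k x)" for x
  have S_diff: "S x - S y = (\<Sum>k. a k * (L k x - L k y))"
    and S_diff_summable: "summable (\<lambda>k. a k * (L k x - L k y))" for x y
    unfolding S_def right_diff_distrib
    by (auto intro: suminf_diff summable_diff aL_summable)
  have "S \<in> lyap"
  proof (rule lyapI)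
    have "\<bar>S x\<bar> \<le> 2" for x
    proof -
      have s: "summable (\<lambda>k. \<bar>a k * L k x\<bar>)"
        by (rule summable_comparison_test'[OF h(1), of 0]) (simp add: aL)
      have "\<bar>S x\<bar> \<le> (\<Sum>k. \<bar>a k * L k x\<bar>)" unfolding S_def by (rule summable_rabs[OF s])
      also have "\<dots> \<le> suminf h" by (rule suminf_le[OF aL s h(1)])
      finally show ?thesis using h(4) by simp
    qed
    then show "bounded (range S)" by (auto simp: bounded_iff)
    \<comment> \<open>The factor 2 is \<open>suminf h\<close>: summing the termwise bounds
      \<open>h k * g D x y\<close> gives \<open>2 * g D x y\<close>.\<close>
    show D2: "(\<lambda>x y. 2 * D x y) \<in> gage" by (intro gage_scale D) simp
    have S_le_D: "S x - S y \<le> D x y" for x y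
      unfolding S_diff D_def
    proof (rule suminf_le[OF _ S_diff_summable wd_summable])
      fix k
      have "a k * (L k x - L k y) \<le> a k * d k x y"
        using d(2)[of k x y] a(1)[of k] by (intro mult_left_mono) auto
      also have "\<dots> \<le> w k * d k x y"
        by (intro mult_right_mono a gage_nonneg[OF d(1)])
      finally show "a k * (L k x - L k y) \<le> w k * d k x y" .
    qed
    fix x y
    show "\<bar>S x - S y\<bar> \<le> 2 * D x y"
      using S_le_D[of x y] S_le_D[of y x] gage_sym[OF D, of x y] gage_nonneg[OF D, of x y] by linarith
    have "S x - S y \<le> (\<Sum>k. h k * g D x y)"
      unfolding S_diff
    proof (rule suminf_le[OF _ S_diff_summable summable_mult2[OF h(1)]])
      fix k
      have "a k * (L k x - L k y) \<le> a k * g (d k) x y"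
        using d(3)[of k x y] a(1)[of k] by (intro mult_left_mono) auto
      also have "\<dots> \<le> h k * g D x y"
        unfolding a_def mult.assoc by (intro mult_left_mono wg less_imp_le[OF h(2)])
      finally show "a k * (L k x - L k y) \<le> h k * g D x y" .
    qed
    also have "\<dots> = 2 * g D x y" using suminf_mult2[OF h(1), of "g D x y"] h(4) by simp
    also have "\<dots> \<le> g (\<lambda>x y. 2 * D x y) x y" by (rule mult_le_scale[OF D]) simp
    finally show "S x - S y \<le> g (\<lambda>x y. 2 * D x y) x y" .
  qed
  moreover have "uniform_limit UNIV (\<lambda>n x. \<Sum>k<n. a k * L k x) S sequentially"
    unfolding S_def by (rule Weierstrass_m_test[OF _ h(1)]) (simp add: aL)
  moreover have "summable a"
    by (rule summable_comparison_test'[OF h(1), of 0]) (simp add: a(3) less_imp_le[OF a(1)])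
  ultimately show "\<exists>a. (\<forall>k. 0 < a k) \<and> summable a \<and>
      (\<exists>M\<in>lyap. uniform_limit UNIV (\<lambda>n x. \<Sum>k<n. a k * L k x) M sequentially)"
    using a(1) by blast
qed

lemma POIN_lyap:
  assumes separates: "\<And>x y :: 'a. x \<noteq> y \<Longrightarrow> \<exists>d\<in>gage. d x y > 0"
  shows "POIN zero_rel lyap"
  unfolding POIN_def
proof (intro allI impI)
  fix x y assume "(x, y) \<notin> Id \<union> zero_rel"
  then obtain d1 where "x \<noteq> y" and d1: "d1 \<in> gage" "g d1 x y \<noteq> 0" by (auto simp: zero_rel_def)
  then obtain d2 where d2: "d2 \<in> gage" "d2 x y > 0" using separates by blast
  \<comment> \<open>Adding \<open>d2\<close> makes \<open>d x y\<close> positive while monotonicity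
    keeps \<open>g d x y\<close> positive.\<close>
  define d where "d = (\<lambda>x y. d1 x y + d2 x y)"
  have d: "d \<in> gage" unfolding d_def by (intro gage_add d1 d2)
  have "g d1 x y \<le> g d x y" by (rule mono1[OF d1(1) d]) (simp add: d_def gage_nonneg[OF d2(1)])
  then have gpos: "g d x y > 0" using nonneg[OF d1(1), of x y] d1(2) by linarith
  have dpos: "d x y > 0" using d2(2) gage_nonneg[OF d1(1), of x y] by (simp add: d_def)
  \<comment> \<open>\<open>g d y y\<close> may be positive, so the minimum with \<open>d z y\<close>
    is what forces \<open>L y = 0\<close>.\<close>
  define L where "L = (\<lambda>z. min (g d z y) (d z y))"
  have "L \<in> lyap"
  proof (rule lyapI[OF _ d])
    obtain B where B: "\<And>x y. d x y \<le> B" using gage_bounded[OF d] by blast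
    have "\<bar>L z\<bar> \<le> B" for z
      using B[of z y] nonneg[OF d, of z y] gage_nonneg[OF d, of z y] unfolding L_def by linarith
    then show "bounded (range L)" by (auto simp: bounded_iff)
    have *: "L u - L v \<le> d u v" for u v
      using triangle_left[OF d, of u y v] gage_triangle[OF d, of u y v] unfolding L_def by linarith
    fix u v
    show "\<bar>L u - L v\<bar> \<le> d u v" using *[of u v] *[of v u] gage_sym[OF d, of u v] by linarith
    \<comment> \<open>If \<open>L v\<close> is the barrier term, \<open>triangle\<close> applies; if
      it is the distance term, \<open>triangle_right\<close> does.\<close>
    show "L u - L v \<le> g d u v"
      using triangle[OF d, of u y v] triangle_right[OF d, of u y v] unfolding L_def by linarith
  qed
  moreover have "L y < L x"
    using gpos dpos nonneg[OF d, of y y] by (simp add: L_def gage_refl[OF d])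
  ultimately show "\<exists>L\<in>lyap. L y < L x" by blast
qed

end

text \<open>A fixed point belongs to its own image, so regularity would require
  \<open>L x < L x\<close>.\<close>

lemma fixed_points_subset_critical_points: "fixed_points F \<subseteq> critical_points F L"
  by (auto simp: fixed_points_def critical_points_def regular_point_def)

theorem theorem5p8:
  fixes f :: "'a::{uniform_space, t2_space} rel"
  shows
    "((\<forall>L\<in>lyap_l f. lyapunov_function (aubry_mather_rel f) L \<and>
          aubry_mather_rel f \<subseteq> le_rel L \<and>
          fixed_points (aubry_mather_rel f) \<subseteq> critical_points (aubry_mather_rel f) L) \<and>
      ALG (lyap_l f) \<and> CON (lyap_l f) \<and> POIN (aubry_mather_rel f) (lyap_l f)) \<and>
     ((\<forall>L\<in>lyap_m f. lyapunov_function (conley_rel f) L \<and>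
          conley_rel f \<subseteq> le_rel L \<and>
          fixed_points (conley_rel f) \<subseteq> critical_points (conley_rel f) L) \<and>
      ALG (lyap_m f) \<and> CON (lyap_m f) \<and> POIN (conley_rel f) (lyap_m f))"
proof -
  interpret l: gage_barrier "\<lambda>d. barrier_l d f" by (rule gage_barrier_l)
  interpret m: gage_barrier "\<lambda>d. barrier_m d f" by (rule gage_barrier_m)
  \<comment> \<open>The concrete collections and relations are the abstract ones with the barrier
    substituted for \<open>g\<close>.\<close>
  have l: "lyap_l f = l.lyap" "aubry_mather_rel f = l.zero_rel"
    by (simp_all add: lyap_l_def l.lyap_def aubry_mather_rel_def l.zero_rel_def)
  have m: "lyap_m f = m.lyap" "conley_rel f = m.zero_rel"
    by (simp_all add: lyap_m_def m.lyap_def conley_rel_def m.zero_rel_def)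
  show ?thesis
    unfolding l m
    by (intro conjI ballI fixed_points_subset_critical_points
        l.lyap_lyapunov_function l.lyap_le_rel l.ALG_lyap l.CON_lyap l.POIN_lyap[OF gage_separates]
        m.lyap_lyapunov_function m.lyap_le_rel m.ALG_lyap m.CON_lyap m.POIN_lyap[OF gage_separates])
qed

end
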